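(* Let $(\mathcal{N},\mathcal{L})$ be the graph of a connected network with shunt set $\mathcal{T}$. Suppose that: (i) the branches are not mutually coupled and every branch has nonzero series admittance, so that $\mathbf{Y}_{\mathcal{L}}=\mathrm{diag}(\mathbf{y}_{\mathcal{L}})$ is diagonal and full rank; (ii) every branch $l\in\mathcal{L}$ has nodal admittance matrix $\mathbf{a}_l\,y_l\,\mathbf{a}_l^H$ with $\mathbf{a}_l$ as described in the context (nonzero complex tap ratio $a_l$); (iii) $\mathrm{Re}(y_l)\ge 0$ for every entry $y_l$ of $\mathbf{y}_{\mathcal{L}}$ and $\mathrm{Re}(y_t)\ge 0$ for every entry $y_t$ of $\mathbf{y}_{\mathcal{T}}$. Let $\mathcal{L}'\subseteq\mathcal{L}$ be the set of purely reactive branches (those with $\mathrm{Re}(y_l)=0$), let $\mathcal{N}'\subseteq\mathcal{N}$ be the set of non-isolated nodes of the graph $(\mathcal{N},\mathcal{L}')$ (nodes that are an endpoint of at least one branch of $\mathcal{L}'$), and let $\mathcal{T}'\subseteq\mathcal{T}$ be the set of purely reactive shunts (zero real part) attached to some node of $\mathcal{N}'$. Let the graph $(\mathcal{N}',\mathcal{L}')$ have $K\ge 0$ connected components, with node sets $\mathcal{N}'(k)$ and branch sets $\mathcal{L}'(k)$, $k=1,\dots,K$, and let $\mathcal{T}'(k)\subseteq\mathcal{T}'$ be the set of shunts of $\mathcal{T}'$ attached to nodes of $\mathcal{N}'(k)$. For each $k$ let $$\mathbf{Y}_{\mathcal{N}'(k)}=\mathbf{A}_{\mathcal{L}'(k),\mathcal{N}'(k)}^H\,\mathbf{Y}_{\mathcal{L}'(k)}\,\mathbf{A}_{\mathcal{L}'(k),\mathcal{N}'(k)}+\mathbf{Y}_{\mathcal{T}'(k)}$$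 be the admittance matrix of the network with nodes $\mathcal{N}'(k)$, branches $\mathcal{L}'(k)$ and shunts $\mathcal{T}'(k)$. If $$\mathrm{Null}(\mathbf{Y}_{\mathcal{N}'(k)})\subseteq\mathrm{Null}(\mathbf{A}_{\mathcal{L}'(k),\mathcal{N}'(k)})\quad\text{for all }k=1,\dots,K$$ (vacuously true if $K=0$), then $$\mathrm{Null}(\mathbf{Y}_{\mathcal{N}})\subseteq\mathrm{Null}(\mathbf{A}_{\mathcal{L},\mathcal{N}}),$$ where $\mathbf{Y}_{\mathcal{N}}=\mathbf{A}_{\mathcal{L},\mathcal{N}}^H\mathbf{Y}_{\mathcal{L}}\mathbf{A}_{\mathcal{L},\mathcal{N}}+\mathbf{Y}_{\mathcal{T}}$ is the admittance matrix of the whole network.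
   Context: A network consists of a finite nonempty set $\mathcal{N}$ of nodes (the ground node is not included), a finite set $\mathcal{L}$ of branches, and a finite set $\mathcal{T}$ of shunts. Each branch $l\in\mathcal{L}$ goes from a node $i$ to a different node $k$ and carries a series admittance $y_l\in\mathbb{C}$ and a tap ratio $a_l\in\mathbb{C}\setminus\{0\}$. Its vector $\mathbf{a}_l\in\mathbb{C}^{|\mathcal{N}|}$ has $i$-th entry $1$, $k$-th entry $-a_l^*$ (complex conjugate of $-a_l$), and all other entries zero; the admittance matrix of this branch alone is $\mathbf{Y}_l=\mathbf{a}_l y_l\mathbf{a}_l^H\in\mathbb{C}^{|\mathcal{N}|\times|\mathcal{N}|}$. Several branches may join the same two nodes, but there are no parallel branches with the same tap ratio (such branches are merged by adding admittances). Each shunt is attached to one node (connecting it to ground), has nonzero complex admittance, and there is at most one shunt per node (parallel shunts are merged). For a set of branches $\mathcal{L}$ all of whose endpoints lie in a node set $\mathcal{N}$, $\mathbf{A}_{\mathcal{L},\mathcal{N}}\in\mathbb{C}^{|\mathcal{L}|\times|\mathcal{N}|}$ is the generalized incidence matrix, whose row for the branch $l$ is $\mathbf{a}_l^H$ with coordinates indexed by $\mathcal{N}$ (entries $1$ at $i$, $-a_l$ at $k$, zero elsewhere). $\mathbf{Y}_{\mathcal{L}}=\mathrm{diag}(\mathbf{y}_{\mathcal{L}})$ is the diagonal matrix of series admittances of the branches in $\mathcal{L}$. For a set $\mathcal{T}$ of shunts at nodes of $\mathcal{N}$, $\mathbf{Y}_{\mathcal{T}}=\mathrm{diag}(\mathbf{y}_{\mathcal{T}})\in\mathbb{C}^{|\mathcal{N}|\times|\mathcal{N}|}$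 is the diagonal matrix whose $n$-th diagonal entry is the admittance of the shunt of $\mathcal{T}$ at node $n$ (zero if there is none); $\mathbf{Y}_{\mathcal{T}'(k)}$ is indexed by $\mathcal{N}'(k)$. The network is connected if the graph $(\mathcal{N},\mathcal{L})$ is connected (ground and shunts are not used for connectivity). $(\cdot)^H$ is the conjugate transpose and $\mathrm{Null}(\cdot)$ the null space over $\mathbb{C}$. *)

theory Defs
  imports
    Complex_Main
    "HOL-Library.Countable_Set"
    "Jordan_Normal_Form.Matrix_Kernel"
    "Jordan_Normal_Form.Schur_Decomposition"
    "Graph_Theory.Digraph_Component"
begin

text \<open>
  Branches are the arcs of a directed multigraph: branch \<open>l\<close> goes from \<open>tail l\<close> to \<open>head l\<close>. The
  orientation only matters for the tap ratio; connectivity is that of the underlying undirected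
  graph (\<open>Digraph_Component.connected\<close>). The ground is not a node.
\<close>
record ('n, 'l, 't) network =
  graph :: "('n, 'l) pre_digraph"
  branch_admittance :: "'l \<Rightarrow> complex"
  tap :: "'l \<Rightarrow> complex"
  shunts :: "'t set"
  shunt_node :: "'t \<Rightarrow> 'n"
  shunt_admittance :: "'t \<Rightarrow> complex"

abbreviation nodes :: "('n, 'l, 't) network \<Rightarrow> 'n set" where
  "nodes W \<equiv> verts (graph W)"

abbreviation branches :: "('n, 'l, 't) network \<Rightarrow> 'l set" where
  "branches W \<equiv> arcs (graph W)"

locale wf_network =
  fin_digraph "graph W" + loopfree_digraph "graph W"
  for W :: "('n, 'l, 't) network" +
  assumes nodes_nonempty: "nodes W \<noteq> {}"
    and tap_nonzero: "\<And>l. l \<in> branches W \<Longrightarrow> tap W l \<noteq> 0"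
    and no_parallel_same_tap:
      "\<And>l m. \<lbrakk>l \<in> branches W; m \<in> branches W; tail (graph W) l = tail (graph W) m;
        head (graph W) l = head (graph W) m; tap W l = tap W m\<rbrakk> \<Longrightarrow> l = m"
    and finite_shunts: "finite (shunts W)"
    and shunt_node_in_nodes: "\<And>t. t \<in> shunts W \<Longrightarrow> shunt_node W t \<in> nodes W"
    and one_shunt_per_node: "inj_on (shunt_node W) (shunts W)"
    and shunt_admittance_nonzero: "\<And>t. t \<in> shunts W \<Longrightarrow> shunt_admittance W t \<noteq> 0"

text \<open>
  Library vectors and matrices are indexed by natural numbers. A finite index set \<open>S\<close> is identified
  with \<open>{..<card S}\<close> through the bijection \<open>from_nat_into S\<close>
  (see \<open>bij_betw_from_nat_into_finite\<close>); all matrices of a network use the same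
  enumeration of its nodes and of its branches.
\<close>

text \<open>
  The admittance matrix of branch \<open>l\<close> alone is \<open>a y a\<^sup>H\<close> with \<open>a = branch_vec W l\<close> and
  \<open>y = branch_admittance W l\<close>; \<open>admittance_matrix\<close> below is the sum of these matrices over all
  branches (no mutual coupling) plus the diagonal matrix of the shunts.
\<close>
definition branch_vec :: "('n, 'l, 't) network \<Rightarrow> 'l \<Rightarrow> complex vec" where
  "branch_vec W l = vec (card (nodes W)) (\<lambda>j.
     let n = from_nat_into (nodes W) j in
       if n = tail (graph W) l then 1
       else if n = head (graph W) l then - cnj (tap W l)
       else 0)"

text \<open>The row of branch \<open>l\<close> is the conjugate transpose of \<open>branch_vec W l\<close>.\<close>
definition incidence_matrix :: "('n, 'l, 't) network \<Rightarrow> complex mat" where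
  "incidence_matrix W = mat_of_rows (card (nodes W))
     (map (\<lambda>i. conjugate (branch_vec W (from_nat_into (branches W) i))) [0..<card (branches W)])"

definition branch_admittance_diag :: "('n, 'l, 't) network \<Rightarrow> complex mat" where
  "branch_admittance_diag W =
     mat_diag (card (branches W)) (\<lambda>i. branch_admittance W (from_nat_into (branches W) i))"

text \<open>With at most one shunt per node, the sum has at most one term.\<close>
definition shunt_admittance_diag :: "('n, 'l, 't) network \<Rightarrow> complex mat" where
  "shunt_admittance_diag W =
     mat_diag (card (nodes W)) (\<lambda>j.
       \<Sum>t | t \<in> shunts W \<and> shunt_node W t = from_nat_into (nodes W) j. shunt_admittance W t)"

definition admittance_matrix :: "('n, 'l, 't) network \<Rightarrow> complex mat" where
  "admittance_matrix W =
     mat_adjoint (incidence_matrix W) * branch_admittance_diag W * incidence_matrix W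
       + shunt_admittance_diag W"

definition reactive_branches :: "('n, 'l, 't) network \<Rightarrow> 'l set" where
  "reactive_branches W = {l \<in> branches W. Re (branch_admittance W l) = 0}"

definition reactive_nodes :: "('n, 'l, 't) network \<Rightarrow> 'n set" where
  "reactive_nodes W =
     {n \<in> nodes W. \<exists>l \<in> reactive_branches W. n = tail (graph W) l \<or> n = head (graph W) l}"

definition reactive_shunts :: "('n, 'l, 't) network \<Rightarrow> 't set" where
  "reactive_shunts W =
     {t \<in> shunts W. Re (shunt_admittance W t) = 0 \<and> shunt_node W t \<in> reactive_nodes W}"

definition reactive_graph :: "('n, 'l, 't) network \<Rightarrow> ('n, 'l) pre_digraph" where
  "reactive_graph W = \<lparr>verts = reactive_nodes W, arcs = reactive_branches W,
     tail = tail (graph W), head = head (graph W)\<rparr>"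

text \<open>Maximality is with respect to nodes and branches, so components are induced subgraphs.\<close>
definition components :: "('n, 'l) pre_digraph \<Rightarrow> ('n, 'l) pre_digraph set" where
  "components G = {C. pre_digraph.max_subgraph G Digraph_Component.connected C}"

definition reactive_subnetwork ::
  "('n, 'l, 't) network \<Rightarrow> ('n, 'l) pre_digraph \<Rightarrow> ('n, 'l, 't) network" where
  "reactive_subnetwork W C =
     W\<lparr>graph := C, shunts := {t \<in> reactive_shunts W. shunt_node W t \<in> verts C}\<rparr>"

end

theory Submission
  imports Defs
begin

text \<open>
  Let \<open>Y v = 0\<close>. The real part of \<open>v\<^sup>H Y v\<close> is a sum of nonnegative terms \<open>Re y |u|\<^sup>2\<close>, where \<open>u\<close> is
  the voltage drop of a branch or the voltage of a shunt. So the drop vanishes on every branch, and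
  the voltage at every shunt, that is not purely reactive. Hence, at a node of a reactive
  component, only elements of that component carry current, and the restriction of \<open>v\<close> to the
  component lies in the kernel of its admittance matrix. By hypothesis the drops vanish
  on its branches too, and every reactive branch lies in some component.
\<close>

section \<open>Connected components\<close>

text \<open>Reachability in \<open>mk_symmetric G\<close> is symmetric, so any two vertices are
  joined by a walk through the root \<open>r\<close>.\<close>

lemma connected_if_reachable_from:
  assumes "wf_digraph G" "r \<in> verts G" "\<And>v. v \<in> verts G \<Longrightarrow> r \<rightarrow>\<^sup>*\<^bsub>mk_symmetric G\<^esub> v"
  shows "Digraph_Component.connected G"
proof -
  interpret pair_wf_digraph "mk_symmetric G"
    using assms(1) by (rule wf_digraph.wellformed_mk_symmetric)
  show ?thesis
    unfolding Digraph_Component.connected_def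
  proof (rule strongly_connectedI)
    show "verts (with_proj (mk_symmetric G)) \<noteq> {}"
      using assms(2) by auto
    fix u v assume "u \<in> verts (with_proj (mk_symmetric G))" "v \<in> verts (with_proj (mk_symmetric G))"
    then have "r \<rightarrow>\<^sup>*\<^bsub>mk_symmetric G\<^esub> u" "r \<rightarrow>\<^sup>*\<^bsub>mk_symmetric G\<^esub> v"
      using assms(3) by auto
    then show "u \<rightarrow>\<^sup>*\<^bsub>mk_symmetric G\<^esub> v"
      by (rule reachable_trans[OF symmetric_reachable[OF symmetric_mk_symmetric]])
  qed
qed

text \<open>One end of \<open>l\<close> may be a new vertex. The symmetric closure allows
  \<open>l\<close> to be crossed in both directions, so that vertex is reached from the end already
  in \<open>G\<close>; old walks survive because \<open>mk_symmetric G\<close> is a subgraph of the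
  new closure.\<close>

lemma connected_add_arc:
  assumes wf: "wf_digraph G" and conn: "Digraph_Component.connected G"
    and inc: "tail G l \<in> verts G \<or> head G l \<in> verts G"
  shows "Digraph_Component.connected (pre_digraph.add_arc G l)"
proof -
  let ?D = "pre_digraph.add_arc G l"
  note simps = pre_digraph.verts_add_arc_conv pre_digraph.arcs_add_arc
    pre_digraph.tail_add_arc pre_digraph.head_add_arc
  have wfD: "wf_digraph ?D"
    using wf by (rule wf_digraph.wf_digraph_add_arc)
  interpret D: pair_wf_digraph "mk_symmetric ?D"
    using wfD by (rule wf_digraph.wellformed_mk_symmetric)
  have sub: "subgraph (mk_symmetric G) (mk_symmetric ?D)"
    by (rule subgraph_mk_symmetric)
      (use wf wfD in \<open>auto simp: subgraph_def compatible_def simps\<close>)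
  \<comment> \<open>The root is an end of \<open>l\<close> inside \<open>G\<close>: old vertices are
    reached by connectedness of \<open>G\<close>, and the other end of \<open>l\<close> by the arc
    itself.\<close>
  define r where "r = (if tail G l \<in> verts G then tail G l else head G l)"
  have r: "r \<in> verts G" "r = tail G l \<or> r = head G l"
    using inc by (auto simp: r_def)
  have reach: "r \<rightarrow>\<^sup>*\<^bsub>mk_symmetric ?D\<^esub> v" if "v \<in> verts G" for v
    using conn r(1) that pre_digraph.reachable_mono[OF _ sub]
    by (auto simp: Digraph_Component.connected_def strongly_connected_def)
  have "(tail G l, head G l) \<in> parcs (mk_symmetric ?D)" "(head G l, tail G l) \<in> parcs (mk_symmetric ?D)"
    by (auto simp: parcs_mk_symmetric simps)
  then have "tail G l \<rightarrow>\<^sup>*\<^bsub>mk_symmetric ?D\<^esub> head G l" "head G l \<rightarrow>\<^sup>*\<^bsub>mk_symmetric ?D\<^esub> tail G l"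
    by (simp_all add: D.reachable_adjI)
  moreover have "r \<rightarrow>\<^sup>*\<^bsub>mk_symmetric ?D\<^esub> r"
    using r(1) by (rule reach)
  ultimately have "r \<rightarrow>\<^sup>*\<^bsub>mk_symmetric ?D\<^esub> tail G l" "r \<rightarrow>\<^sup>*\<^bsub>mk_symmetric ?D\<^esub> head G l"
    using r(2) by metis+
  then show ?thesis
    using r(1) reach by (intro connected_if_reachable_from[OF wfD, of r]) (auto simp: simps)
qed

lemma componentsD:
  assumes "C \<in> components G"
  shows "subgraph C G" "Digraph_Component.connected C"
  using assms by (auto simp: components_def pre_digraph.max_subgraph_def)

text \<open>Maximality at work: enlarging \<open>C\<close> by an incident arc gives a connected
  subgraph of \<open>G\<close> above \<open>C\<close>, which must be \<open>C\<close> itself. This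
  is what keeps foreign reactive branches away from the nodes of a reactive component.\<close>

lemma components_incident_arc:
  assumes C: "C \<in> components G" and l: "l \<in> arcs G"
    and inc: "tail G l \<in> verts C \<or> head G l \<in> verts C"
  shows "l \<in> arcs C"
proof -
  let ?D = "pre_digraph.add_arc C l"
  note simps = pre_digraph.verts_add_arc_conv pre_digraph.arcs_add_arc
    pre_digraph.tail_add_arc pre_digraph.head_add_arc
  have sub: "subgraph C G" and conn: "Digraph_Component.connected C"
    using componentsD[OF C] by auto
  have wf: "wf_digraph C" "wf_digraph G" and comp: "tail C = tail G" "head C = head G"
    using sub by (auto simp: subgraph_def compatible_def)
  have wfD: "wf_digraph ?D"
    using wf(1) by (rule wf_digraph.wf_digraph_add_arc)
  have "Digraph_Component.connected ?D"
    using wf(1) conn inc comp by (intro connected_add_arc) auto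
  moreover have "subgraph C ?D"
    using wf wfD by (auto simp: subgraph_def compatible_def simps)
  moreover have "subgraph ?D G"
    using sub wf wfD l comp wf_digraph.wellformed[OF wf(2) l]
    by (auto simp: subgraph_def compatible_def simps)
  ultimately have "?D = C"
    using C by (auto simp: components_def pre_digraph.max_subgraph_def)
  then show ?thesis
    by (metis insertI1 pre_digraph.arcs_add_arc)
qed

text \<open>Since \<open>G\<close> is finite, some connected subgraph through \<open>u\<close> has
  the largest number of vertices plus arcs; no connected subgraph properly extends it.\<close>

lemma (in fin_digraph) ex_component_of_vertex:
  assumes u: "u \<in> verts G"
  shows "\<exists>C \<in> components G. u \<in> verts C"
proof -
  define P where
    "P H \<longleftrightarrow> subgraph H G \<and> Digraph_Component.connected H \<and> u \<in> verts H" for H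
  define size where "size H = card (verts H) + card (arcs H)" for H :: "('a, 'b) pre_digraph"
  \<comment> \<open>The single vertex \<open>u\<close> shows that there is a candidate. It inherits
    \<open>tail\<close> and \<open>head\<close> from \<open>G\<close>, as \<open>compatible\<close>
    requires.\<close>
  let ?H0 = "\<lparr>verts = {u}, arcs = {}, tail = tail G, head = head G\<rparr>"
  have wf0: "wf_digraph ?H0"
    by unfold_locales auto
  interpret H0: pair_wf_digraph "mk_symmetric ?H0"
    using wf0 by (rule wf_digraph.wellformed_mk_symmetric)
  have "Digraph_Component.connected ?H0"
    by (rule connected_if_reachable_from[OF wf0, of u]) auto
  then have P0: "P ?H0"
    using u wf0 wf_digraph by (auto simp: P_def subgraph_def compatible_def)
  have "size H \<le> card (verts G) + card (arcs G)" if "P H" for H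
    using that by (auto simp: P_def size_def subgraph_def intro!: add_mono card_mono)
  then obtain C where C: "P C" and max: "\<And>H. P H \<Longrightarrow> size H \<le> size C"
    using ex_has_greatest_nat[of P ?H0 size "Suc (card (verts G) + card (arcs G))"] P0
    by (auto simp: less_Suc_eq_le)
  have "H = C" if H: "subgraph C H" "subgraph H G" "Digraph_Component.connected H" for H
  proof -
    have "P H"
      using H C by (auto simp: P_def subgraph_def)
    then have le: "size H \<le> size C"
      by (rule max)
    have sub: "verts C \<subseteq> verts H" "arcs C \<subseteq> arcs H"
      and fin: "finite (verts H)" "finite (arcs H)"
      using H by (auto simp: subgraph_def intro: finite_subset[OF _ finite_verts] finite_subset[OF _ finite_arcs])
    have "card (verts C) \<le> card (verts H)" "card (arcs C) \<le> card (arcs H)"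
      using sub fin by (auto intro: card_mono)
    \<comment> \<open>Neither summand of \<open>size\<close> can shrink from \<open>C\<close> to
      \<open>H\<close>, and their sum does not grow, so both stay equal.\<close>
    then have "card (verts C) = card (verts H)" "card (arcs C) = card (arcs H)"
      using le by (auto simp: size_def)
    then have "verts C = verts H" "arcs C = arcs H"
      using sub fin by (simp_all add: card_subset_eq)
    moreover have "tail H = tail C" "head H = head C"
      using H(1) by (auto simp: subgraph_def compatible_def)
    ultimately show ?thesis
      by simp
  qed
  then have "C \<in> components G"
    using C by (auto simp: components_def max_subgraph_def P_def)
  then show ?thesis
    using C by (auto simp: P_def)
qed

section \<open>Kernels in terms of branch voltage drops and nodal currents\<close>

text \<open>The entry of \<open>incidence_matrix W\<close> times the voltage vector that belongs to
  branch \<open>l\<close>.\<close>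

definition branch_drop :: "('n, 'l, 't) network \<Rightarrow> ('n \<Rightarrow> complex) \<Rightarrow> 'l \<Rightarrow> complex" where
  "branch_drop W x l = x (tail (graph W) l) - tap W l * x (head (graph W) l)"

text \<open>The entries of \<open>branch_vec W l\<close>, indexed by nodes instead of
  positions.\<close>

definition branch_coeff :: "('n, 'l, 't) network \<Rightarrow> 'l \<Rightarrow> 'n \<Rightarrow> complex" where
  "branch_coeff W l n =
     (if n = tail (graph W) l then 1 else if n = head (graph W) l then - cnj (tap W l) else 0)"

definition node_shunt_admittance :: "('n, 'l, 't) network \<Rightarrow> 'n \<Rightarrow> complex" where
  "node_shunt_admittance W n = (\<Sum>t | t \<in> shunts W \<and> shunt_node W t = n. shunt_admittance W t)"

definition nodal_current :: "('n, 'l, 't) network \<Rightarrow> ('n \<Rightarrow> complex) \<Rightarrow> 'n \<Rightarrow> complex" where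
  "nodal_current W x n =
     (\<Sum>l\<in>branches W. branch_coeff W l n * branch_admittance W l * branch_drop W x l)
       + node_shunt_admittance W n * x n"

text \<open>A network and its subnetworks enumerate their nodes differently, so their vectors cannot
  be compared position by position. One function \<open>x\<close> on nodes serves all of them:
  \<open>node_vec\<close> of a subnetwork restricts it to the nodes there.\<close>

definition node_vec :: "('n, 'l, 't) network \<Rightarrow> ('n \<Rightarrow> complex) \<Rightarrow> complex vec" where
  "node_vec W x = vec (card (nodes W)) (\<lambda>j. x (from_nat_into (nodes W) j))"

lemma node_vec_carrier [simp]: "node_vec W x \<in> carrier_vec (card (nodes W))"
  by (simp add: node_vec_def)

section \<open>Passing between positions and nodes or branches\<close>

lemma sum_from_nat_into:
  assumes "finite S"
  shows "(\<Sum>j<card S. f (from_nat_into S j)) = sum f S"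
  using sum.reindex_bij_betw[OF bij_betw_from_nat_into_finite[OF assms]] .

lemma from_nat_into_less_card:
  assumes "finite S" "i < card S"
  shows "from_nat_into S i \<in> S"
  using assms by (intro from_nat_into) auto

lemma ball_from_nat_into:
  assumes "finite S"
  shows "(\<forall>i<card S. P (from_nat_into S i)) \<longleftrightarrow> (\<forall>s\<in>S. P s)"
proof -
  have "(\<forall>s\<in>S. P s) \<longleftrightarrow> (\<forall>s\<in>from_nat_into S ` {..<card S}. P s)"
    using bij_betw_imp_surj_on[OF bij_betw_from_nat_into_finite[OF assms]] by simp
  then show ?thesis
    by auto
qed

lemma node_vec_surj:
  assumes "finite (nodes W)" "v \<in> carrier_vec (card (nodes W))"
  obtains x where "v = node_vec W x"
proof
  define e where "e = from_nat_into (nodes W)"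
  have "inj_on e {..<card (nodes W)}"
    unfolding e_def using bij_betw_from_nat_into_finite[OF assms(1)] by (rule bij_betw_imp_inj_on)
  \<comment> \<open>The witness looks up the position of a node by inverting the
    enumeration.\<close>
  then show "v = node_vec W (\<lambda>n. v $ the_inv_into {..<card (nodes W)} e n)"
    using assms(2) by (intro eq_vecI) (auto simp: node_vec_def e_def the_inv_into_f_f)
qed

lemma incidence_matrix_carrier [simp]:
  "incidence_matrix W \<in> carrier_mat (card (branches W)) (card (nodes W))"
  by (simp add: incidence_matrix_def mat_of_rows_def)

lemma incidence_matrix_index:
  assumes "i < card (branches W)" "j < card (nodes W)"
  shows "incidence_matrix W $$ (i, j) =
    cnj (branch_coeff W (from_nat_into (branches W) i) (from_nat_into (nodes W) j))"
  using assms
  by (auto simp: incidence_matrix_def mat_of_rows_index branch_vec_def branch_coeff_def Let_def)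

lemma mat_adjoint_index:
  assumes "i < dim_col A" "j < dim_row A"
  shows "mat_adjoint A $$ (i, j) = conjugate (A $$ (j, i))"
  using assms by (auto simp: mat_adjoint_def mat_of_rows_index)

text \<open>Only the two ends of \<open>l\<close> contribute. They are distinct by loop-freeness, so
  the first case of \<open>branch_coeff\<close> does not hide the second, and the conjugate of
  \<open>- cnj (tap W l)\<close> is \<open>- tap W l\<close>.\<close>

lemma sum_branch_coeff:
  assumes "wf_digraph (graph W)" "loopfree_digraph (graph W)" "finite (nodes W)"
    and l: "l \<in> branches W"
  shows "(\<Sum>n\<in>nodes W. cnj (branch_coeff W l n) * x n) = branch_drop W x l"
proof -
  let ?s = "tail (graph W) l" and ?d = "head (graph W) l"
  have "?s \<noteq> ?d" "?s \<in> nodes W" "?d \<in> nodes W"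
    using assms(1,2) l
    by (auto simp: loopfree_digraph.no_loops wf_digraph.tail_in_verts wf_digraph.head_in_verts)
  moreover from this have "(\<Sum>n\<in>nodes W. cnj (branch_coeff W l n) * x n)
      = (\<Sum>n\<in>{?s, ?d}. cnj (branch_coeff W l n) * x n)"
    using assms(3) by (intro sum.mono_neutral_right) (auto simp: branch_coeff_def)
  ultimately show ?thesis
    by (simp add: branch_coeff_def branch_drop_def)
qed

text \<open>These facts are applied both to the whole network and to each reactive subnetwork, hence
  the setting of an arbitrary finite loop-free graph.\<close>

context
  fixes W :: "('n, 'l, 't) network"
  assumes fin: "fin_digraph (graph W)" and loopfree: "loopfree_digraph (graph W)"
begin

private lemma wf: "wf_digraph (graph W)"
  using fin by (simp add: fin_digraph_def)

private lemma finite_nodes: "finite (nodes W)"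
  using fin by (rule fin_digraph.finite_verts)

private lemma finite_branches: "finite (branches W)"
  using fin by (rule fin_digraph.finite_arcs)

lemma incidence_matrix_node_vec:
  "incidence_matrix W *\<^sub>v node_vec W x
     = vec (card (branches W)) (\<lambda>i. branch_drop W x (from_nat_into (branches W) i))"
proof (rule eq_vecI)
  fix i assume "i < dim_vec (vec (card (branches W)) (\<lambda>i. branch_drop W x (from_nat_into (branches W) i)))"
  then have i: "i < card (branches W)" by simp
  let ?l = "from_nat_into (branches W) i"
  have "(incidence_matrix W *\<^sub>v node_vec W x) $ i
      = (\<Sum>j<card (nodes W). cnj (branch_coeff W ?l (from_nat_into (nodes W) j))
          * x (from_nat_into (nodes W) j))"
    using i carrier_matD[OF incidence_matrix_carrier[of W]]
    by (auto simp: scalar_prod_def incidence_matrix_index node_vec_def atLeast0LessThan intro!: sum.cong)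
  also have "\<dots> = (\<Sum>n\<in>nodes W. cnj (branch_coeff W ?l n) * x n)"
    by (rule sum_from_nat_into[OF finite_nodes])
  also have "\<dots> = branch_drop W x ?l"
    using sum_branch_coeff[OF wf loopfree finite_nodes from_nat_into_less_card[OF finite_branches i]] .
  finally show "(incidence_matrix W *\<^sub>v node_vec W x) $ i
      = vec (card (branches W)) (\<lambda>i. branch_drop W x (from_nat_into (branches W) i)) $ i"
    using i by simp
qed (use carrier_matD[OF incidence_matrix_carrier[of W]] in auto)

lemma node_vec_in_kernel_incidence_matrix:
  "node_vec W x \<in> mat_kernel (incidence_matrix W) \<longleftrightarrow> (\<forall>l\<in>branches W. branch_drop W x l = 0)"
  unfolding mat_kernel[OF incidence_matrix_carrier] mem_Collect_eq incidence_matrix_node_vec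
  by (auto simp: vec_eq_iff simp flip: ball_from_nat_into[OF finite_branches])

lemma admittance_matrix_carrier:
  "admittance_matrix W \<in> carrier_mat (card (nodes W)) (card (nodes W))"
  using carrier_matD[OF incidence_matrix_carrier[of W]]
  by (auto simp: admittance_matrix_def shunt_admittance_diag_def mat_diag_def)

text \<open>Reading the product from right to left: the incidence matrix yields the drops, the
  diagonal matrix turns them into branch currents, and the adjoint collects these at the
  nodes.\<close>

lemma admittance_matrix_node_vec:
  "admittance_matrix W *\<^sub>v node_vec W x
     = vec (card (nodes W)) (\<lambda>j. nodal_current W x (from_nat_into (nodes W) j))"
proof -
  let ?N = "card (nodes W)" and ?L = "card (branches W)"
  let ?A = "incidence_matrix W" and ?Y = "branch_admittance_diag W"
  let ?en = "from_nat_into (nodes W)" and ?el = "from_nat_into (branches W)"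
  note A = incidence_matrix_carrier[of W]
  have AH: "mat_adjoint ?A \<in> carrier_mat ?N ?L"
    using carrier_matD[OF A] by (auto simp: mat_adjoint_def)
  have Y: "?Y \<in> carrier_mat ?L ?L"
    by (simp add: branch_admittance_diag_def)
  have S: "shunt_admittance_diag W \<in> carrier_mat ?N ?N"
    by (simp add: shunt_admittance_diag_def)
  have diag: "(mat_diag m f *\<^sub>v w) $ i = f i * w $ i" if "i < m" "w \<in> carrier_vec m"
    for m i :: nat and f :: "nat \<Rightarrow> complex" and w
  proof -
    have "(mat_diag m f *\<^sub>v w) $ i = (\<Sum>j<m. (if i = j then f j else 0) * w $ j)"
      using that by (auto simp: mat_diag_def scalar_prod_def atLeast0LessThan intro!: sum.cong)
    also have "\<dots> = (\<Sum>j<m. if i = j then f i * w $ i else 0)"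
      by (intro sum.cong) auto
    also have "\<dots> = f i * w $ i"
      using that by simp
    finally show ?thesis .
  qed
  have "admittance_matrix W *\<^sub>v node_vec W x
      = mat_adjoint ?A *\<^sub>v (?Y *\<^sub>v (?A *\<^sub>v node_vec W x)) + shunt_admittance_diag W *\<^sub>v node_vec W x"
    unfolding admittance_matrix_def
    using A AH Y S
    by (simp add: add_mult_distrib_mat_vec[of _ ?N ?N] assoc_mult_mat_vec[of _ ?N ?L _ ?N]
        assoc_mult_mat_vec[of _ ?L ?L _ ?N] assoc_mult_mat[of _ ?N ?L _ ?L _ ?N])
  also have "\<dots> = vec ?N (\<lambda>j. nodal_current W x (?en j))"
  proof (rule eq_vecI)
    fix j assume "j < dim_vec (vec ?N (\<lambda>j. nodal_current W x (?en j)))"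
    then have j: "j < ?N" by simp
    let ?w = "?Y *\<^sub>v (?A *\<^sub>v node_vec W x)"
    have w: "?w $ i = branch_admittance W (?el i) * branch_drop W x (?el i)" if "i < ?L" for i
      using that by (simp add: branch_admittance_diag_def incidence_matrix_node_vec diag)
    have "(mat_adjoint ?A *\<^sub>v ?w) $ j = (\<Sum>i<?L. mat_adjoint ?A $$ (j, i) * ?w $ i)"
      using j AH Y by (auto simp: scalar_prod_def atLeast0LessThan intro!: sum.cong)
    \<comment> \<open>The conjugation in the adjoint cancels the one in the entries of
      \<open>incidence_matrix\<close>.\<close>
    also have "\<dots> = (\<Sum>i<?L. branch_coeff W (?el i) (?en j) * branch_admittance W (?el i) * branch_drop W x (?el i))"
      using j carrier_matD[OF A] by (intro sum.cong) (auto simp: w mat_adjoint_index incidence_matrix_index)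
    also have "\<dots> = (\<Sum>l\<in>branches W. branch_coeff W l (?en j) * branch_admittance W l * branch_drop W x l)"
      by (rule sum_from_nat_into[OF finite_branches])
    finally have 1: "(mat_adjoint ?A *\<^sub>v ?w) $ j = \<dots>" .
    have 2: "(shunt_admittance_diag W *\<^sub>v node_vec W x) $ j = node_shunt_admittance W (?en j) * x (?en j)"
      using j by (simp add: shunt_admittance_diag_def diag node_shunt_admittance_def) (simp add: node_vec_def)
    show "(mat_adjoint ?A *\<^sub>v ?w + shunt_admittance_diag W *\<^sub>v node_vec W x) $ j
        = vec ?N (\<lambda>j. nodal_current W x (?en j)) $ j"
      using j carrier_matD[OF S] by (simp add: 1 2 nodal_current_def)
  qed (use carrier_matD[OF S] in auto)
  finally show ?thesis .
qed

lemma node_vec_in_kernel_admittance_matrix: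
  "node_vec W x \<in> mat_kernel (admittance_matrix W) \<longleftrightarrow> (\<forall>n\<in>nodes W. nodal_current W x n = 0)"
  unfolding mat_kernel[OF admittance_matrix_carrier] mem_Collect_eq admittance_matrix_node_vec
  by (auto simp: vec_eq_iff simp flip: ball_from_nat_into[OF finite_nodes])

section \<open>Power balance and dissipation\<close>

text \<open>The quadratic form of the admittance matrix at \<open>x\<close>. After exchanging the
  sums over nodes and branches, the inner sum over nodes is the conjugate of the drop on the
  branch.\<close>

lemma complex_power:
  "(\<Sum>n\<in>nodes W. cnj (x n) * nodal_current W x n)
     = (\<Sum>l\<in>branches W. branch_admittance W l * (cmod (branch_drop W x l))\<^sup>2)
       + (\<Sum>n\<in>nodes W. node_shunt_admittance W n * (cmod (x n))\<^sup>2)"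
proof -
  have sq: "cnj z * z = (cmod z)\<^sup>2" for z
    by (simp only: complex_norm_square mult.commute)
  have "(\<Sum>n\<in>nodes W. cnj (x n) * nodal_current W x n)
      = (\<Sum>n\<in>nodes W. \<Sum>l\<in>branches W. cnj (x n) * (branch_coeff W l n * branch_admittance W l * branch_drop W x l))
        + (\<Sum>n\<in>nodes W. node_shunt_admittance W n * (cnj (x n) * x n))"
    by (simp add: nodal_current_def distrib_left sum.distrib sum_distrib_left mult_ac)
  also have "(\<Sum>n\<in>nodes W. \<Sum>l\<in>branches W. cnj (x n) * (branch_coeff W l n * branch_admittance W l * branch_drop W x l))
      = (\<Sum>l\<in>branches W. branch_admittance W l * (cnj (\<Sum>n\<in>nodes W. cnj (branch_coeff W l n) * x n) * branch_drop W x l))"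
    by (subst sum.swap) (simp add: sum_distrib_left sum_distrib_right mult_ac)
  also have "\<dots> = (\<Sum>l\<in>branches W. branch_admittance W l * (cmod (branch_drop W x l))\<^sup>2)"
    by (intro sum.cong) (simp_all add: sum_branch_coeff[OF wf loopfree finite_nodes] sq)
  finally show ?thesis
    by (simp add: sq)
qed

text \<open>With zero nodal currents the real part of \<open>complex_power\<close> is a vanishing
  sum of nonnegative terms, so every term is zero.\<close>

lemma passive_kernel_dissipation:
  assumes shunts: "finite (shunts W)" "\<And>t. t \<in> shunts W \<Longrightarrow> shunt_node W t \<in> nodes W"
    and passive_branches: "\<And>l. l \<in> branches W \<Longrightarrow> Re (branch_admittance W l) \<ge> 0"
    and passive_shunts: "\<And>t. t \<in> shunts W \<Longrightarrow> Re (shunt_admittance W t) \<ge> 0"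
    and kernel: "\<And>n. n \<in> nodes W \<Longrightarrow> nodal_current W x n = 0"
  shows "\<And>l. l \<in> branches W \<Longrightarrow> Re (branch_admittance W l) \<noteq> 0 \<Longrightarrow> branch_drop W x l = 0"
    and "\<And>t. t \<in> shunts W \<Longrightarrow> Re (shunt_admittance W t) \<noteq> 0 \<Longrightarrow> x (shunt_node W t) = 0"
proof -
  let ?B = "\<Sum>l\<in>branches W. Re (branch_admittance W l) * (cmod (branch_drop W x l))\<^sup>2"
  let ?S = "\<Sum>n\<in>nodes W. Re (node_shunt_admittance W n) * (cmod (x n))\<^sup>2"
  have re_shunt: "Re (node_shunt_admittance W n)
      = (\<Sum>t | t \<in> shunts W \<and> shunt_node W t = n. Re (shunt_admittance W t))" for n
    by (simp add: node_shunt_admittance_def Re_sum)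
  have shunt_nonneg: "Re (node_shunt_admittance W n) \<ge> 0" for n
    using passive_shunts by (auto simp: re_shunt intro: sum_nonneg)
  have "0 = Re (\<Sum>n\<in>nodes W. cnj (x n) * nodal_current W x n)"
    using kernel by simp
  also have "\<dots> = ?B + ?S"
    by (simp only: complex_power plus_complex.simps Re_sum) (simp flip: of_real_power)
  finally have "?B + ?S = 0" by simp
  moreover have "?B \<ge> 0" "?S \<ge> 0"
    using passive_branches shunt_nonneg by (auto intro!: sum_nonneg)
  ultimately have "?B = 0" "?S = 0"
    by auto
  then have B: "\<And>l. l \<in> branches W \<Longrightarrow> Re (branch_admittance W l) * (cmod (branch_drop W x l))\<^sup>2 = 0"
    and S: "\<And>n. n \<in> nodes W \<Longrightarrow> Re (node_shunt_admittance W n) * (cmod (x n))\<^sup>2 = 0"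
    using passive_branches shunt_nonneg finite_nodes finite_branches
    by (auto simp: sum_nonneg_eq_0_iff)
  show "branch_drop W x l = 0" if "l \<in> branches W" "Re (branch_admittance W l) \<noteq> 0" for l
    using B that by auto
  show "x (shunt_node W t) = 0" if t: "t \<in> shunts W" "Re (shunt_admittance W t) \<noteq> 0" for t
  proof -
    \<comment> \<open>The other shunts at the node have nonnegative real part and cannot cancel that
      of \<open>t\<close>; so the total at the node is positive too.\<close>
    have "Re (shunt_admittance W t) \<le> Re (node_shunt_admittance W (shunt_node W t))"
      unfolding re_shunt using t passive_shunts shunts(1) by (intro member_le_sum) auto
    then have "Re (node_shunt_admittance W (shunt_node W t)) \<noteq> 0"
      using t passive_shunts[of t] by linarith
    then show ?thesis
      using S[of "shunt_node W t"] shunts(2) t by auto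
  qed
qed

end

section \<open>Restriction to a reactive component\<close>

lemma wf_digraph_reactive_graph:
  assumes "wf_digraph (graph W)"
  shows "wf_digraph (reactive_graph W)"
  using assms
  by unfold_locales
    (auto simp: reactive_graph_def reactive_nodes_def reactive_branches_def wf_digraph.wellformed)

lemma fin_digraph_reactive_graph:
  assumes "fin_digraph (graph W)"
  shows "fin_digraph (reactive_graph W)"
proof -
  interpret fin_digraph "graph W" by fact
  show ?thesis
    using wf_digraph_reactive_graph[OF wf_digraph_axioms]
    by (auto intro!: wf_digraph.fin_digraphI
      simp: reactive_graph_def reactive_nodes_def reactive_branches_def)
qed

text \<open>Everything at \<open>n\<close> that the subnetwork leaves out carries no current:
  dissipative branches have zero drop, dissipative shunts see zero voltage, and reactive branches
  outside \<open>C\<close> do not touch \<open>n\<close>.\<close>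

lemma nodal_current_reactive_subnetwork:
  assumes fin: "fin_digraph (graph W)" and C: "C \<in> components (reactive_graph W)"
    and shunts: "finite (shunts W)"
    and drop: "\<And>l. l \<in> branches W \<Longrightarrow> Re (branch_admittance W l) \<noteq> 0 \<Longrightarrow> branch_drop W x l = 0"
    and ground: "\<And>t. t \<in> shunts W \<Longrightarrow> Re (shunt_admittance W t) \<noteq> 0 \<Longrightarrow> x (shunt_node W t) = 0"
    and n: "n \<in> verts C"
  shows "nodal_current (reactive_subnetwork W C) x n = nodal_current W x n"
proof -
  let ?R = "reactive_subnetwork W C"
  have sub: "verts C \<subseteq> reactive_nodes W" "arcs C \<subseteq> reactive_branches W"
    and comp: "tail C = tail (graph W)" "head C = head (graph W)"
    using componentsD(1)[OF C] by (auto simp: subgraph_def compatible_def reactive_graph_def)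
  have coeff: "branch_coeff ?R = branch_coeff W" and drop_eq: "branch_drop ?R x = branch_drop W x"
    by (auto simp: fun_eq_iff branch_coeff_def branch_drop_def reactive_subnetwork_def comp)
  have "(\<Sum>l\<in>arcs C. branch_coeff W l n * branch_admittance W l * branch_drop W x l)
      = (\<Sum>l\<in>branches W. branch_coeff W l n * branch_admittance W l * branch_drop W x l)"
  proof (rule sum.mono_neutral_left)
    show "finite (branches W)"
      using fin by (rule fin_digraph.finite_arcs)
    show "arcs C \<subseteq> branches W"
      using sub by (auto simp: reactive_branches_def)
    \<comment> \<open>A reactive branch with a nonzero coefficient at \<open>n\<close> ends at
      \<open>n\<close>, so maximality would put it into \<open>C\<close>.\<close>
    have "branch_coeff W l n = 0"
      if "l \<in> branches W" "l \<notin> arcs C" "Re (branch_admittance W l) = 0" for l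
      using components_incident_arc[OF C, of l] that n
      by (auto simp: reactive_graph_def reactive_branches_def branch_coeff_def)
    then show "\<forall>l\<in>branches W - arcs C. branch_coeff W l n * branch_admittance W l * branch_drop W x l = 0"
      using drop by auto
  qed
  \<comment> \<open>The factor \<open>x n\<close> stays inside the sum: the omitted shunts at
    \<open>n\<close> have nonzero real part, so it is \<open>x n\<close> that makes their terms
    vanish.\<close>
  moreover have "(\<Sum>t | t \<in> shunts ?R \<and> shunt_node W t = n. shunt_admittance W t * x n)
      = (\<Sum>t | t \<in> shunts W \<and> shunt_node W t = n. shunt_admittance W t * x n)"
    using shunts ground n sub
    by (intro sum.mono_neutral_left) (auto simp: reactive_subnetwork_def reactive_shunts_def)
  ultimately show ?thesis
    unfolding nodal_current_def node_shunt_admittance_def sum_distrib_right coeff drop_eq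
    by (simp add: reactive_subnetwork_def)
qed

section \<open>From the components back to the whole network\<close>

theorem theorem2:
  fixes W :: "('n, 'l, 't) network"
  assumes wf: "wf_network W"
    and conn: "Digraph_Component.connected (graph W)"
    and nonzero: "\<And>l. l \<in> branches W \<Longrightarrow> branch_admittance W l \<noteq> 0"
    and passive_branches: "\<And>l. l \<in> branches W \<Longrightarrow> Re (branch_admittance W l) \<ge> 0"
    and passive_shunts: "\<And>t. t \<in> shunts W \<Longrightarrow> Re (shunt_admittance W t) \<ge> 0"
    and reactive_components: "\<And>C. C \<in> components (reactive_graph W) \<Longrightarrow>
           mat_kernel (admittance_matrix (reactive_subnetwork W C))
             \<subseteq> mat_kernel (incidence_matrix (reactive_subnetwork W C))"
  shows "mat_kernel (admittance_matrix W) \<subseteq> mat_kernel (incidence_matrix W)"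
proof
  interpret wf_network W by fact
  note W = fin_digraph_axioms loopfree_digraph_axioms
  fix v assume v: "v \<in> mat_kernel (admittance_matrix W)"
  then obtain x where x: "v = node_vec W x"
    using mat_kernel_carrier[OF admittance_matrix_carrier[OF W]] node_vec_surj[OF finite_verts] by blast
  have current: "\<And>n. n \<in> nodes W \<Longrightarrow> nodal_current W x n = 0"
    using v by (simp add: x node_vec_in_kernel_admittance_matrix[OF W])
  note dissipation = passive_kernel_dissipation[OF W finite_shunts shunt_node_in_nodes
      passive_branches passive_shunts current]
  have "branch_drop W x l = 0" if l: "l \<in> branches W" for l
  proof (cases "Re (branch_admittance W l) = 0")
    case True
    let ?G = "reactive_graph W"
    have lG: "l \<in> arcs ?G" "tail (graph W) l \<in> verts ?G"
      using True l by (auto simp: reactive_graph_def reactive_branches_def reactive_nodes_def)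
    then obtain C where C: "C \<in> components ?G" and tl: "tail (graph W) l \<in> verts C"
      using fin_digraph.ex_component_of_vertex[OF fin_digraph_reactive_graph[OF W(1)]] by blast
    \<comment> \<open>\<open>C\<close> was chosen only to contain the tail of \<open>l\<close>;
      maximality brings in the branch.\<close>
    have lC: "l \<in> arcs C"
      using components_incident_arc[OF C lG(1)] tl by (simp add: reactive_graph_def)
    let ?R = "reactive_subnetwork W C"
    have wfC: "wf_digraph C" and sub: "verts C \<subseteq> nodes W" "arcs C \<subseteq> branches W"
      and comp: "tail C = tail (graph W)" "head C = head (graph W)"
      using componentsD(1)[OF C]
      by (auto simp: subgraph_def compatible_def reactive_graph_def reactive_nodes_def reactive_branches_def)
    have finC: "fin_digraph (graph ?R)"
      using wf_digraph.fin_digraphI[OF wfC] sub finite_subset[OF _ finite_verts] finite_subset[OF _ finite_arcs]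
      by (simp add: reactive_subnetwork_def)
    have loopC: "loopfree_digraph (graph ?R)"
      using wfC sub comp no_loops
      by (auto simp: reactive_subnetwork_def loopfree_digraph_def loopfree_digraph_axioms_def)
    have "nodal_current ?R x n = 0" if "n \<in> nodes ?R" for n
      using nodal_current_reactive_subnetwork[OF W(1) C finite_shunts dissipation, of n] current sub that
      by (auto simp: reactive_subnetwork_def)
    \<comment> \<open>The restriction of \<open>x\<close> to \<open>C\<close> is in the kernel of
      the admittance matrix of the component, so the hypothesis on components applies.\<close>
    then have "node_vec ?R x \<in> mat_kernel (incidence_matrix ?R)"
      using reactive_components[OF C] node_vec_in_kernel_admittance_matrix[OF finC loopC] by blast
    then have "branch_drop ?R x l = 0"
      unfolding node_vec_in_kernel_incidence_matrix[OF finC loopC]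
      using lC by (auto simp: reactive_subnetwork_def)
    then show ?thesis
      by (simp add: branch_drop_def reactive_subnetwork_def comp)
  \<comment> \<open>A branch with positive real part has zero drop directly by dissipation.\<close>
  qed (use dissipation(1) l in auto)
  then show "v \<in> mat_kernel (incidence_matrix W)"
    by (simp add: x node_vec_in_kernel_incidence_matrix[OF W])
qed

end
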